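(* There exist absolute constants $C>0$ and $c_0>0$ such that the following holds. Let $D>0$ and let $\mu_D$ be the probability distribution on $[D,2D]$ with density $x\mapsto 2D/x^2$ on $[D,2D]$ (and $0$ elsewhere). Let $\eta$ satisfy $0<\eta\le c_0D$, and let $\mu'$ be any probability distribution on $(0,+\infty)$ with $\mathrm{EMD}(\mu_D,\mu')\le\eta$. Then every 4-robust schedule $X$ satisfies \[\mathbb{E}_{z\sim\mu'}[\ell(X,z)]\ \ge\ \frac{\mathbb{E}_{z\sim\mu'}[z]}{4\ln 2+C\sqrt{\eta/D}}.\]
   Context: A (contract) schedule is an increasing bi-infinite sequence $X=(x_i)_{i\in\mathbb{Z}}$ of positive reals with $\sum_{j\le i}x_j<\infty$; contracts are executed consecutively and contract $i$ completes at time $\sum_{j\le i}x_j$. For $T>0$, $\ell(X,T)$ is the largest length $x_i$ of a contract completed by time $T$. The robustness of $X$ is $\sup_{T>0}T/\ell(X,T)$; $X$ is $r$-robust if this is at most $r$. For probability distributions $\mu,\mu'$ on $\mathbb{R}^+$, the Earth Mover's Distance is $\mathrm{EMD}(\mu,\mu')=\inf_{\psi}\int\!\!\int|x-y|\,d\psi(x,y)$, the infimum over all couplings $\psi$ (probability measures on $\mathbb{R}^+\times\mathbb{R}^+$ with marginals $\mu$ and $\mu'$). *)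

theory Defs
  imports "HOL-Probability.Probability"
begin

definition schedule :: "(int \<Rightarrow> real) \<Rightarrow> bool" where
  "schedule X \<longleftrightarrow> strict_mono X \<and> (\<forall>i. 0 < X i) \<and> (\<forall>i. X summable_on {..i})"

definition completion_time :: "(int \<Rightarrow> real) \<Rightarrow> int \<Rightarrow> real" where
  "completion_time X i = (\<Sum>\<^sub>\<infinity>j\<in>{..i}. X j)"

(* For a schedule and T > 0 the maximum exists: completion times tend to 0 as the index
   tends to -infinity and to +infinity as it tends to +infinity.
   For T \<le> 0 no contract is completed and the value is unspecified. *)
definition largest_completed :: "(int \<Rightarrow> real) \<Rightarrow> real \<Rightarrow> real" where
  "largest_completed X T = (GREATEST l. \<exists>i. l = X i \<and> completion_time X i \<le> T)"

(* Taken in the extended reals because the supremum may be infinite. *)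
definition robustness :: "(int \<Rightarrow> real) \<Rightarrow> ereal" where
  "robustness X = (SUP T\<in>{0<..}. ereal (T / largest_completed X T))"

definition robust :: "real \<Rightarrow> (int \<Rightarrow> real) \<Rightarrow> bool" where
  "robust r X \<longleftrightarrow> robustness X \<le> ereal r"

(* Distributions on the positive half-line are Borel measures on the whole real line
   that give it full mass. *)
definition pos_distribution :: "real measure \<Rightarrow> bool" where
  "pos_distribution M \<longleftrightarrow> prob_space M \<and> sets M = sets borel \<and> emeasure M {0<..} = 1"

(* If both marginals are concentrated on the positive half-line, then so is every coupling
   on its square. *)
definition couplings :: "real measure \<Rightarrow> real measure \<Rightarrow> (real \<times> real) measure set" where
  "couplings M N = {P. prob_space P \<and> sets P = sets (borel \<Otimes>\<^sub>M borel) \<and>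
     distr P borel fst = M \<and> distr P borel snd = N}"

definition EMD :: "real measure \<Rightarrow> real measure \<Rightarrow> ennreal" where
  "EMD M N = (INF P\<in>couplings M N. \<integral>\<^sup>+ (x, y). ennreal \<bar>x - y\<bar> \<partial>P)"

definition mu :: "real \<Rightarrow> real measure" where
  "mu D = density lborel (\<lambda>x. ennreal (if x \<in> {D..2 * D} then 2 * D / x\<^sup>2 else 0))"

end

theory Submission
  imports Defs
begin

text \<open>4-robustness is so tight that it forces the completion times to double at every step, so
  that \<open>\<ell>(X,z)\<close> is the step function \<open>a 2\<^sup>i\<close> for \<open>2 a 2\<^sup>i \<le> z < 4 a 2\<^sup>i\<close>. Exactly one jump \<open>b\<close> of it
  lies in \<open>(D, 2D]\<close>, and the density \<open>2D/x\<^sup>2\<close> is chosen so that its expectation is \<open>D/2\<close> wherever \<open>b\<close>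
  is; the expectation of \<open>z\<close> is \<open>2D ln 2\<close>, which gives the ratio \<open>4 ln 2\<close>. For \<open>\<mu>'\<close>, take a coupling
  \<open>(x, y)\<close> of cost at most \<open>2\<eta>\<close> and \<open>d = \<surd>(\<eta>D)\<close>. Then \<open>\<ell>(y) \<ge> \<ell>(x)\<close> unless \<open>\<bar>x - y\<bar> \<ge> d\<close>, which
  has probability \<open>O(\<eta>/d)\<close>, or \<open>x\<close> lies at most \<open>d\<close> above \<open>D\<close> or \<open>b\<close>, which has probability
  \<open>O(d/D)\<close>. Either event costs at most \<open>D\<close>, hence the total loss is \<open>O(D \<surd>(\<eta>/D))\<close>.\<close>

section \<open>Completion times of a schedule\<close>

lemma completion_time_plus_1:
  assumes "schedule X"
  shows "completion_time X (i + 1) = completion_time X i + X (i + 1)"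
proof -
  have "{..i + 1} = insert (i + 1) {..i}" by auto
  then show ?thesis
    using assms by (simp add: completion_time_def schedule_def infsum_insert)
qed

lemma completion_time_pos:
  assumes "schedule X"
  shows "0 < completion_time X i"
proof -
  have "0 \<le> completion_time X (i - 1)"
    unfolding completion_time_def using assms
    by (intro infsum_nonneg) (auto simp: schedule_def less_imp_le)
  moreover have "0 < X i" using assms by (simp add: schedule_def)
  ultimately show ?thesis using completion_time_plus_1[OF assms, of "i - 1"] by simp
qed

lemma completion_time_less:
  assumes "schedule X" "i < j"
  shows "completion_time X i < completion_time X j"
  using assms(2)
proof (induction j rule: int_gr_induct)
  case base
  then show ?case
    using assms(1) completion_time_plus_1[OF assms(1), of i] by (simp add: schedule_def)
next
  case (step j)
  have "0 < X (j + 1)" using assms(1) by (simp add: schedule_def)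
  with step show ?case using completion_time_plus_1[OF assms(1), of j] by simp
qed

text \<open>Contract lengths increase with the index, so the longest completed contract is the last
  completed one.\<close>

lemma largest_completed_eq:
  assumes "schedule X" "completion_time X i \<le> z" "z < completion_time X (i + 1)"
  shows "largest_completed X z = X i"
  unfolding largest_completed_def
proof (rule Greatest_equality)
  show "\<exists>j. X i = X j \<and> completion_time X j \<le> z" using assms(2) by blast
next
  fix l assume "\<exists>j. l = X j \<and> completion_time X j \<le> z"
  then obtain j where j: "l = X j" "completion_time X j \<le> z" by blast
  have "j \<le> i"
  proof (rule ccontr)
    assume "\<not> j \<le> i"
    then have "j = i + 1 \<or> i + 1 < j" by linarith
    then have "completion_time X (i + 1) \<le> completion_time X j"
      using completion_time_less[OF assms(1), of "i + 1" j] by auto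
    then show False using j assms(3) by simp
  qed
  then show "l \<le> X i"
    using assms(1) j(1) by (simp add: schedule_def strict_mono_less_eq)
qed

section \<open>Rigidity of 4-robust schedules\<close>

text \<open>Just before contract \<open>i + 1\<close> completes, \<open>X i\<close> is still the
  longest completed length. The completion time itself is only a limit of such \<open>z\<close>,
  hence the density argument.\<close>

lemma robust_next_completion_time_le:
  assumes "schedule X" "robust r X"
  shows "completion_time X (i + 1) \<le> r * X i"
proof (rule dense_le_bounded[OF completion_time_less[OF assms(1), of i "i + 1"]])
  show "i < i + 1" by simp
next
  fix z assume z: "completion_time X i < z" "z < completion_time X (i + 1)"
  have "0 < z" using z(1) completion_time_pos[OF assms(1), of i] by linarith
  then have "ereal (z / largest_completed X z) \<le> robustness X"
    unfolding robustness_def by (intro SUP_upper) simp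
  also have "\<dots> \<le> ereal r" using assms(2) by (simp add: robust_def)
  finally have "z / X i \<le> r"
    using largest_completed_eq[OF assms(1), of i z] z by simp
  moreover have "0 < X i" using assms(1) by (simp add: schedule_def)
  ultimately show "z \<le> r * X i" by (simp add: pos_divide_le_eq)
qed

text \<open>For the ratios \<open>q i\<close> of consecutive completion times the recursion below is what
  4-robustness says. Since \<open>4 (1 - 1/q) \<le> q - (q - 2)\<^sup>2/4\<close>, the ratios decrease, and a value
  below 2 would drive them to \<open>-\<infinity>\<close> in the future, a value above 2 to \<open>\<infinity>\<close> in the past.\<close>

lemma bounded_ratio_recursion_eq_2:
  fixes q :: "int \<Rightarrow> real"
  assumes pos: "\<And>i. 0 < q i" and le: "\<And>i. q i \<le> 4"
    and rec: "\<And>i. q (i + 1) \<le> 4 * (1 - 1 / q i)"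
  shows "q k = 2"
proof -
  have dec: "q (i + 1) \<le> q i - (q i - 2)\<^sup>2 / 4" for i
  proof -
    have "4 * (1 - 1 / q i) = q i - (q i - 2)\<^sup>2 / q i"
      using pos[of i] by (simp add: field_simps power2_eq_square)
    moreover have "(q i - 2)\<^sup>2 / 4 \<le> (q i - 2)\<^sup>2 / q i"
      using pos[of i] le[of i] by (intro divide_left_mono) auto
    ultimately show ?thesis using rec[of i] by linarith
  qed
  define e where "e = (q k - 2)\<^sup>2 / 4"
  have "e \<le> 0"
  proof (rule ccontr)
    assume "\<not> e \<le> 0"
    then have e: "0 < e" by simp
    \<comment> \<open>All ratios lie between 0 and 4. Moving away from 2 increases the distance to
      it, so every move has size at least \<open>e\<close>, and \<open>n\<close> moves lead out of
      this range.\<close>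
    obtain n :: nat where n: "4 < real n * e"
      using reals_Archimedean3[OF e] by blast
    have ne: "0 \<le> real m * e" for m using e by simp
    show False
    proof (cases "q k < 2")
      case True
      have "q (k + int m) \<le> q k - real m * e" for m
      proof (induction m)
        case (Suc m)
        have "2 - q k \<le> 2 - q (k + int m)" using Suc ne[of m] by linarith
        then have "(2 - q k)\<^sup>2 \<le> (2 - q (k + int m))\<^sup>2"
          using True by (intro power_mono) auto
        then have "e \<le> (q (k + int m) - 2)\<^sup>2 / 4"
          by (simp add: e_def power2_commute)
        then show ?case
          using dec[of "k + int m"] Suc by (simp add: algebra_simps)
      qed simp
      from this[of n] show False using n pos[of "k + int n"] True by linarith
    next
      case False
      have "q k + real m * e \<le> q (k - int m)" for m
      proof (induction m)
        case (Suc m)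
        let ?j = "k - int (Suc m)"
        have j: "?j + 1 = k - int m" by simp
        have "q (?j + 1) \<le> q ?j"
          using dec[of ?j] zero_le_power2[of "q ?j - 2"] by linarith
        then have "q k - 2 \<le> q ?j - 2" using Suc ne[of m] unfolding j by linarith
        then have "(q k - 2)\<^sup>2 \<le> (q ?j - 2)\<^sup>2"
          using False by (intro power_mono) auto
        then have "e \<le> (q ?j - 2)\<^sup>2 / 4" by (simp add: e_def)
        then show ?case using dec[of ?j] Suc unfolding j by (simp add: algebra_simps)
      qed simp
      from this[of n] show False using n le[of "k - int n"] False by linarith
    qed
  qed
  then show ?thesis by (simp add: e_def)
qed

lemma robust_4_completion_time_double:
  assumes "schedule X" "robust 4 X"
  shows "completion_time X (i + 1) = 2 * completion_time X i"
proof -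
  let ?T = "completion_time X"
  note pos = completion_time_pos[OF assms(1)]
  \<comment> \<open>\<open>X i\<close> is a difference of completion times. Division by
    \<open>?T i\<close> turns this into the recursion for the ratios; dropping the positive
    \<open>?T (i - 1)\<close> bounds them by 4.\<close>
  have key: "?T (i + 1) \<le> 4 * (?T i - ?T (i - 1))" for i
    using robust_next_completion_time_le[OF assms, of i]
      completion_time_plus_1[OF assms(1), of "i - 1"] by simp
  have "?T (i + 1) / ?T i = 2"
  proof (rule bounded_ratio_recursion_eq_2[where q = "\<lambda>i. ?T (i + 1) / ?T i"])
    fix i
    show "0 < ?T (i + 1) / ?T i" using pos by simp
    show "?T (i + 1) / ?T i \<le> 4"
      using pos[of i] pos[of "i - 1"] key[of i] by (simp add: pos_divide_le_eq)
    show "?T (i + 1 + 1) / ?T (i + 1) \<le> 4 * (1 - 1 / (?T (i + 1) / ?T i))"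
      using key[of "i + 1"] pos[of i] pos[of "i + 1"] by (simp add: field_simps)
  qed
  then show ?thesis using pos[of i] by (simp add: field_simps)
qed

text \<open>Since completion times double, every contract lasts exactly as long as all earlier ones
  together.\<close>

lemma robust_4_geometric:
  assumes "schedule X" "robust 4 X"
  shows "X i = X 0 * 2 powr real_of_int i" "completion_time X i = 2 * X i"
proof -
  have T: "completion_time X i = 2 * X i" for i
    using robust_4_completion_time_double[OF assms, of "i - 1"]
      completion_time_plus_1[OF assms(1), of "i - 1"] by simp
  have dbl: "X (i + 1) = 2 * X i" for i
    using robust_4_completion_time_double[OF assms, of i] by (simp add: T)
  show "X i = X 0 * 2 powr real_of_int i"
  proof (induction i rule: int_induct[where k = 0])
    case (step1 i)
    then show ?case using dbl[of i] by (simp add: powr_add)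
  next
    case (step2 i)
    then show ?case using dbl[of "i - 1"] by (simp add: powr_diff)
  qed simp
  show "completion_time X i = 2 * X i" by (rule T)
qed

section \<open>Dyadic step functions\<close>

text \<open>For positive \<open>z\<close> this is \<open>largest_completed\<close> when contract
  \<open>i\<close> has length \<open>a * 2 powr i\<close> and completes at twice that time; the
  floor is the index of the last completed contract.\<close>

definition dyadic_step :: "real \<Rightarrow> real \<Rightarrow> real" where
  "dyadic_step a z = a * 2 powr real_of_int \<lfloor>log 2 (z / (2 * a))\<rfloor>"

lemma dyadic_step_eqI:
  assumes "0 < a" "2 * (a * 2 powr real_of_int i) \<le> z" "z < 4 * (a * 2 powr real_of_int i)"
  shows "dyadic_step a z = a * 2 powr real_of_int i"
proof -
  have "0 < 2 * (a * 2 powr real_of_int i)" using assms(1) by simp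
  then have z: "0 < z" using assms(2) by linarith
  have "\<lfloor>log 2 (z / (2 * a))\<rfloor> = i"
    using assms z by (intro floor_unique) (auto simp: le_log_iff log_less_iff powr_add field_simps)
  then show ?thesis by (simp add: dyadic_step_def)
qed

lemma dyadic_step_bounds:
  assumes "0 < a" "0 < z"
  shows "0 < dyadic_step a z" "2 * dyadic_step a z \<le> z" "z < 4 * dyadic_step a z"
proof -
  let ?y = "z / (2 * a)"
  have y: "0 < ?y" using assms by simp
  show "0 < dyadic_step a z" using assms by (simp add: dyadic_step_def)
  have "2 powr real_of_int \<lfloor>log 2 ?y\<rfloor> \<le> ?y"
    using y by (simp flip: le_log_iff)
  then show "2 * dyadic_step a z \<le> z" using assms by (simp add: dyadic_step_def field_simps)
  have "?y < 2 powr (real_of_int \<lfloor>log 2 ?y\<rfloor> + 1)"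
    using y by (simp flip: log_less_iff)
  then show "z < 4 * dyadic_step a z" using assms by (simp add: dyadic_step_def powr_add field_simps)
qed

text \<open>Stronger than monotonicity: \<open>y\<close> may lie below \<open>x\<close>, as long as
  it does not drop below the left end of the step containing \<open>x\<close>.\<close>

lemma dyadic_step_le_dyadic_step:
  assumes "0 < a" "0 < x" "2 * dyadic_step a x \<le> y"
  shows "dyadic_step a x \<le> dyadic_step a y"
proof -
  note b = dyadic_step_bounds[OF assms(1,2)]
  have "0 < y" using assms b by linarith
  have "2 powr real_of_int \<lfloor>log 2 (x / (2 * a))\<rfloor> \<le> y / (2 * a)"
    using assms by (simp add: dyadic_step_def field_simps)
  then have "real_of_int \<lfloor>log 2 (x / (2 * a))\<rfloor> \<le> log 2 (y / (2 * a))"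
    using \<open>0 < y\<close> assms(1) by (simp add: le_log_iff)
  then show ?thesis using assms(1) by (simp add: dyadic_step_def le_floor_iff)
qed

lemma robust_4_largest_completed:
  assumes "schedule X" "robust 4 X" "0 < z"
  shows "largest_completed X z = dyadic_step (X 0) z"
proof -
  define i where "i = \<lfloor>log 2 (z / (2 * X 0))\<rfloor>"
  have X0: "0 < X 0" using assms(1) by (simp add: schedule_def)
  note g = robust_4_geometric[OF assms(1,2)]
  have s: "dyadic_step (X 0) z = X i" using g(1)[of i] by (simp add: dyadic_step_def i_def)
  have "X (i + 1) = 2 * X i" using g(1)[of i] g(1)[of "i + 1"] by (simp add: powr_add)
  then show ?thesis
    unfolding s using dyadic_step_bounds[OF X0 assms(3)] s
    by (intro largest_completed_eq[OF assms(1)]) (simp_all add: g(2))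
qed

lemma borel_measurable_dyadic_step [measurable]: "dyadic_step a \<in> borel_measurable borel"
  unfolding dyadic_step_def[abs_def] by measurable

text \<open>Jumps are a factor 2 apart, so the half-open octave above \<open>D\<close> contains
  exactly one: the right end \<open>b\<close> of the step containing \<open>D\<close>.\<close>

lemma dyadic_step_on_octave:
  assumes "0 < a" "0 < D"
  defines "b \<equiv> 4 * dyadic_step a D"
  shows "D < b" "b \<le> 2 * D"
    "\<And>x. \<lbrakk>D \<le> x; x < b\<rbrakk> \<Longrightarrow> dyadic_step a x = b / 4"
    "\<And>x. \<lbrakk>b \<le> x; x \<le> 2 * D\<rbrakk> \<Longrightarrow> dyadic_step a x = b / 2"
proof -
  note bd = dyadic_step_bounds[OF assms(1,2)]
  define n where "n = \<lfloor>log 2 (D / (2 * a))\<rfloor>"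
  have n: "dyadic_step a D = a * 2 powr real_of_int n" by (simp add: dyadic_step_def n_def)
  show "D < b" "b \<le> 2 * D" using bd by (simp_all add: b_def)
  show "dyadic_step a x = b / 4" if "D \<le> x" "x < b" for x
    using dyadic_step_eqI[OF assms(1), of n x] that bd n by (simp add: b_def)
  show "dyadic_step a x = b / 2" if "b \<le> x" "x \<le> 2 * D" for x
    using dyadic_step_eqI[OF assms(1), of "n + 1" x] that bd n by (simp add: b_def powr_add)
qed

text \<open>A pointwise bound can be integrated against any coupling. No loss exceeds
  \<open>D\<close>, as \<open>dyadic_step a x\<close> is at most \<open>x / 2\<close>; the last term
  bounds \<open>D\<close> times the indicator of \<open>d \<le> \<bar>x - y\<bar>\<close>, as in
  Markov's inequality.\<close>

lemma dyadic_step_perturbation: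
  assumes "0 < a" "0 < D" "0 < d" "x \<in> {D..2 * D}" "0 < y"
  shows "dyadic_step a x - D * indicator ({D..D + d} \<union> {4 * dyadic_step a D..4 * dyadic_step a D + d}) x
    - D / d * \<bar>x - y\<bar> \<le> dyadic_step a y"
proof -
  let ?B = "{D..D + d} \<union> {4 * dyadic_step a D..4 * dyadic_step a D + d}"
  note s = dyadic_step_on_octave[OF assms(1,2)]
  have x: "0 < x" using assms by simp
  have xD: "dyadic_step a x \<le> D" using dyadic_step_bounds[OF assms(1) x] assms by simp
  have y: "0 < dyadic_step a y" using dyadic_step_bounds[OF assms(1,5)] by simp
  have nn: "0 \<le> D / d * \<bar>x - y\<bar>" using assms by simp
  consider "x \<in> ?B" | "d \<le> \<bar>x - y\<bar>" | "x \<notin> ?B" "\<bar>x - y\<bar> < d" by linarith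
  then show ?thesis
  proof cases
    case 1
    then have "indicator ?B x = (1::real)" by (rule indicator_simps)
    then show ?thesis using xD y nn by simp
  next
    case 2
    then have "D / d * d \<le> D / d * \<bar>x - y\<bar>" using assms by (intro mult_left_mono) auto
    then have "D \<le> D / d * \<bar>x - y\<bar>" using assms by simp
    moreover have "0 \<le> D * indicator ?B x" using assms by simp
    ultimately show ?thesis using xD y by linarith
  next
    case 3
    \<comment> \<open>Below the jump, the step of \<open>x\<close> begins at half the jump, hence at
      or below \<open>D\<close>, and \<open>y > x - d > D\<close>. From the jump on, it begins at
      the jump, and \<open>x - d\<close> lies above that.\<close>
    have "2 * dyadic_step a x \<le> y"
    proof (cases "x < 4 * dyadic_step a D")
      case True
      then show ?thesis using 3 s(1,2) s(3)[of x] assms by auto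
    next
      case False
      then show ?thesis using 3 s(1,2) s(4)[of x] assms by auto
    qed
    then have "dyadic_step a x \<le> dyadic_step a y" by (rule dyadic_step_le_dyadic_step[OF assms(1) x])
    then show ?thesis using 3 nn by simp
  qed
qed

section \<open>Probabilities and expectations under \<open>mu D\<close>\<close>

lemma emeasure_mu_Icc:
  assumes "0 < D" "D \<le> u" "u \<le> v" "v \<le> 2 * D"
  shows "emeasure (mu D) {u..v} = ennreal (2 * D / u - 2 * D / v)"
proof -
  have "emeasure (mu D) {u..v} = (\<integral>\<^sup>+x. ennreal (2 * D / x\<^sup>2) * indicator {u..v} x \<partial>lborel)"
    unfolding mu_def using assms
    by (subst emeasure_density) (auto intro!: nn_integral_cong split: split_indicator)
  also have "\<dots> = ennreal (- 2 * D / v - (- 2 * D / u))"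
  proof (rule nn_integral_FTC_Icc[where F = "\<lambda>x. - 2 * D / x"])
    fix x assume "x \<in> {u..v}"
    then show "((\<lambda>x. - 2 * D / x) has_real_derivative 2 * D / x\<^sup>2) (at x)"
      using assms by (auto intro!: derivative_eq_intros simp: power2_eq_square)
  qed (use assms in auto)
  finally show ?thesis by simp
qed

text \<open>The density is at most its value \<open>2 / D\<close> at \<open>D\<close>. The interval
  may leave the support, as happens for the window above a jump close to
  \<open>2 * D\<close>.\<close>

lemma measure_mu_Icc_le:
  assumes "0 < D" "u \<le> v"
  shows "measure (mu D) {u..v} \<le> 2 / D * (v - u)"
proof -
  have dens: "ennreal (if x \<in> {D..2 * D} then 2 * D / x\<^sup>2 else 0) \<le> ennreal (2 / D)" for x
  proof (cases "x \<in> {D..2 * D}")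
    case True
    then have "D * D \<le> x\<^sup>2"
      using assms by (simp add: power2_eq_square mult_mono)
    then have "2 * D / x\<^sup>2 \<le> 2 * D / (D * D)"
      using assms True by (intro divide_left_mono) auto
    then show ?thesis using True assms by (simp add: ennreal_leI)
  qed (use assms in auto)
  have "emeasure (mu D) {u..v} \<le> (\<integral>\<^sup>+x. ennreal (2 / D) * indicator {u..v} x \<partial>lborel)"
    unfolding mu_def
    by (subst emeasure_density) (use dens in \<open>auto intro!: nn_integral_mono mult_right_mono simp del: ennreal_le_iff\<close>)
  also have "\<dots> = ennreal (2 / D * (v - u))"
    using assms by (simp add: nn_integral_cmult_indicator flip: ennreal_mult)
  finally show ?thesis
    using assms by (simp add: measure_def enn2real_leI)
qed

lemma AE_mu: "AE x in mu D. x \<in> {D..2 * D}"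
  unfolding mu_def by (subst AE_density) auto

lemma sets_mu [measurable_cong, simp]: "sets (mu D) = sets borel"
  by (simp add: mu_def)

lemma prob_space_mu:
  assumes "0 < D"
  shows "prob_space (mu D)"
proof (rule prob_spaceI)
  have "emeasure (mu D) (space (mu D)) = emeasure (mu D) {D..2 * D}"
  proof (rule emeasure_eq_AE)
    show "AE x in mu D. x \<in> space (mu D) \<longleftrightarrow> x \<in> {D..2 * D}"
      using AE_mu[of D] AE_space by eventually_elim simp
  qed (rule sets.top, simp)
  also have "\<dots> = 1" using emeasure_mu_Icc[of D D "2 * D"] assms by simp
  finally show "emeasure (mu D) (space (mu D)) = 1" .
qed

lemma has_bochner_integral_mu_id:
  assumes "0 < D"
  shows "has_bochner_integral (mu D) (\<lambda>x. x) (2 * D * ln 2)"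
proof (rule has_bochner_integral_nn_integral)
  show "AE x in mu D. 0 \<le> x" using AE_mu[of D] by eventually_elim (use assms in auto)
  have "(\<integral>\<^sup>+x. ennreal x \<partial>mu D) = (\<integral>\<^sup>+x. ennreal (2 * D / x) * indicator {D..2 * D} x \<partial>lborel)"
    unfolding mu_def using assms
    by (subst nn_integral_density)
       (auto intro!: nn_integral_cong simp: power2_eq_square split: split_indicator simp flip: ennreal_mult)
  also have "\<dots> = ennreal (2 * D * ln (2 * D) - 2 * D * ln D)"
  proof (rule nn_integral_FTC_Icc)
    fix x assume "x \<in> {D..2 * D}"
    then show "((\<lambda>x. 2 * D * ln x) has_real_derivative 2 * D / x) (at x)"
      using assms by (auto intro!: derivative_eq_intros)
  qed (use assms in auto)
  also have "2 * D * ln (2 * D) - 2 * D * ln D = 2 * D * ln 2"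
    using assms by (simp add: ln_mult algebra_simps)
  finally show "(\<integral>\<^sup>+x. ennreal x \<partial>mu D) = ennreal (2 * D * ln 2)" .
qed (use assms in auto)

text \<open>The value is \<open>b / 4\<close>, plus another \<open>b / 4\<close> with probability
  \<open>2 * D / b - 1\<close>; in the sum \<open>b\<close> cancels.\<close>

lemma has_bochner_integral_mu_dyadic_step:
  assumes "0 < a" "0 < D"
  shows "has_bochner_integral (mu D) (dyadic_step a) (D / 2)"
proof -
  define b where "b = 4 * dyadic_step a D"
  note s = dyadic_step_on_octave[OF assms, folded b_def]
  interpret prob_space "mu D" using assms by (intro prob_space_mu)
  have "emeasure (mu D) {b..2 * D} = ennreal (2 * D / b - 1)"
    using emeasure_mu_Icc[of D b "2 * D"] s assms by simp
  then have m: "measure (mu D) {b..2 * D} = 2 * D / b - 1"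
    using s assms by (simp add: measure_def)
  have "has_bochner_integral (mu D) (\<lambda>x. b / 4 + b / 4 * indicator {b..2 * D} x)
      (b / 4 * measure (mu D) (space (mu D)) + b / 4 * measure (mu D) {b..2 * D})"
    by (intro has_bochner_integral_add has_bochner_integral_mult_right
        has_bochner_integral_real_indicator)
      (auto simp: has_bochner_integral_iff prob_space less_top[symmetric])
  also have "b / 4 * measure (mu D) (space (mu D)) + b / 4 * measure (mu D) {b..2 * D} = D / 2"
    unfolding m prob_space using s assms by (simp add: field_simps)
  finally show ?thesis
  proof (rule has_bochner_integralI_AE)
    show "AE x in mu D. b / 4 + b / 4 * indicator {b..2 * D} x = dyadic_step a x"
      using AE_mu[of D]
    proof eventually_elim
      case (elim x)
      then show ?case using s(3,4)[of x] by (cases "x < b") auto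
    qed
  qed simp
qed

section \<open>Expectations under a coupled distribution\<close>

text \<open>The first bound integrates the pointwise perturbation estimate over the coupling, the
  second \<open>y \<le> x + \<bar>x - y\<bar>\<close>. The width \<open>d\<close> stays free, to be
  balanced against the cost later.\<close>

lemma coupling_expectation_bounds:
  assumes aD: "0 < a" "0 < D" and d: "0 < d" and N: "pos_distribution N"
    and P: "P \<in> couplings (mu D) N" and cost: "(\<integral>\<^sup>+ (x, y). ennreal \<bar>x - y\<bar> \<partial>P) \<le> ennreal e"
    and e: "0 \<le> e"
  shows "D / 2 - 4 * d - D / d * e \<le> (\<integral>y. dyadic_step a y \<partial>N)"
    and "(\<integral>y. y \<partial>N) \<le> 2 * D * ln 2 + e"
proof -
  define B where "B = {D..D + d} \<union> {4 * dyadic_step a D..4 * dyadic_step a D + d}"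
  have fst_P: "distr P borel fst = mu D" and snd_P: "distr P borel snd = N"
    and setsP [measurable_cong]: "sets P = sets (borel \<Otimes>\<^sub>M borel)" and "prob_space P"
    using P by (auto simp: couplings_def)
  interpret mu: prob_space "mu D" using aD by (intro prob_space_mu)
  have [measurable]: "fst \<in> P \<rightarrow>\<^sub>M borel" "snd \<in> P \<rightarrow>\<^sub>M borel" by measurable
  \<comment> \<open>Carries integrability and value together from the first marginal to the
    coupling.\<close>
  have fstI: "has_bochner_integral P (\<lambda>p. f (fst p)) v"
    if "has_bochner_integral (mu D) f v" for f :: "real \<Rightarrow> real" and v
  proof -
    have f: "f \<in> borel_measurable borel"
      using that by (auto simp: has_bochner_integral_iff)
    show ?thesis using that f
      by (simp add: has_bochner_integral_iff integrable_distr_eq integral_distr flip: fst_P)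
  qed
  have [measurable]: "B \<in> sets borel" by (simp add: B_def)
  have AEx: "AE p in P. fst p \<in> {D..2 * D}"
    using AE_mu[of D] unfolding fst_P[symmetric] by (subst (asm) AE_distr_iff) auto
  have sN: "sets N = sets borel" and "prob_space N" and N1: "emeasure N {0<..} = 1"
    using N by (auto simp: pos_distribution_def)
  interpret N: prob_space N by fact
  have "AE y in N. y \<in> {0<..}"
    using N1 sN by (intro N.AE_prob_1) (simp add: N.emeasure_eq_measure)
  then have AEy: "AE p in P. 0 < snd p"
    unfolding snd_P[symmetric] by (subst (asm) AE_distr_iff) auto
  define c where "c = (\<integral>p. \<bar>fst p - snd p\<bar> \<partial>P)"
  have cost': "(\<integral>\<^sup>+ p. ennreal \<bar>fst p - snd p\<bar> \<partial>P) \<le> ennreal e"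
    using cost by (simp add: case_prod_beta')
  \<comment> \<open>Finite cost is what makes \<open>snd\<close>, and then
    \<open>dyadic_step a\<close> of it, integrable; a Bochner integral of a non-integrable function
    would default to 0.\<close>
  have ic: "integrable P (\<lambda>p. \<bar>fst p - snd p\<bar>)"
    using cost' by (intro integrableI_bounded) (auto simp: less_top[symmetric] top_unique)
  have c: "has_bochner_integral P (\<lambda>p. \<bar>fst p - snd p\<bar>) c"
    using ic by (simp add: has_bochner_integral_iff c_def)
  have "ennreal c \<le> ennreal e"
    using cost' ic unfolding c_def by (subst (asm) nn_integral_eq_integral) auto
  then have ce: "c \<le> e" using e by (simp add: ennreal_le_iff)
  note ix = fstI[OF has_bochner_integral_mu_id[OF aD(2)]]
  note isx = fstI[OF has_bochner_integral_mu_dyadic_step[OF aD]]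
  have iy: "integrable P snd"
  proof (rule Bochner_Integration.integrable_bound)
    show "integrable P (\<lambda>p. fst p + \<bar>fst p - snd p\<bar>)"
      using ix ic by (auto simp: has_bochner_integral_iff)
    show "AE p in P. norm (snd p) \<le> norm (fst p + \<bar>fst p - snd p\<bar>)"
      using AEx AEy by eventually_elim (use aD in auto)
  qed simp
  have "(\<integral>p. snd p \<partial>P) \<le> (\<integral>p. fst p + \<bar>fst p - snd p\<bar> \<partial>P)"
    using iy ix ic by (intro integral_mono) (auto simp: has_bochner_integral_iff)
  also have "\<dots> = 2 * D * ln 2 + c"
    using has_bochner_integral_add[OF ix c] by (simp add: has_bochner_integral_iff)
  finally have "(\<integral>p. snd p \<partial>P) \<le> 2 * D * ln 2 + e" using ce by simp
  then show "(\<integral>y. y \<partial>N) \<le> 2 * D * ln 2 + e"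
    unfolding snd_P[symmetric] by (subst integral_distr) auto
  have isy: "integrable P (\<lambda>p. dyadic_step a (snd p))"
  proof (rule Bochner_Integration.integrable_bound[OF iy])
    show "AE p in P. norm (dyadic_step a (snd p)) \<le> norm (snd p)"
      using AEy
    proof eventually_elim
      case (elim p)
      then show ?case using dyadic_step_bounds[OF aD(1) elim] by simp
    qed
  qed simp
  have "has_bochner_integral (mu D) (indicator B) (measure (mu D) B)"
    by (intro has_bochner_integral_real_indicator) (auto simp: less_top[symmetric])
  note iB = fstI[OF this]
  \<comment> \<open>Two windows of width \<open>d\<close> have mass at most \<open>2 * d / D\<close>
    each, and the loss on them is at most \<open>D\<close>: this gives the
    \<open>4 * d\<close>.\<close>
  have "measure (mu D) B \<le> measure (mu D) {D..D + d} + measure (mu D) {4 * dyadic_step a D..4 * dyadic_step a D + d}"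
    unfolding B_def by (intro measure_Un_le) auto
  also have "\<dots> \<le> 2 / D * d + 2 / D * d"
    using measure_mu_Icc_le[OF aD(2), of D "D + d"] d
      measure_mu_Icc_le[OF aD(2), of "4 * dyadic_step a D" "4 * dyadic_step a D + d"] by simp
  finally have "D * measure (mu D) B \<le> 4 * d" using aD by (simp add: field_simps)
  moreover have "D / d * c \<le> D / d * e" using ce aD d by (intro mult_left_mono) auto
  ultimately have le: "D / 2 - 4 * d - D / d * e \<le> D / 2 - D * measure (mu D) B - D / d * c"
    by linarith
  let ?f = "\<lambda>p. dyadic_step a (fst p) - D * indicator B (fst p) - D / d * \<bar>fst p - snd p\<bar>"
  have "has_bochner_integral P ?f (D / 2 - D * measure (mu D) B - D / d * c)"
    by (intro has_bochner_integral_diff has_bochner_integral_mult_right isx iB c)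
  then have I: "integrable P ?f" and "D / 2 - D * measure (mu D) B - D / d * c = (\<integral>p. ?f p \<partial>P)"
    by (auto simp: has_bochner_integral_iff)
  note this(2)
  also have "\<dots> \<le> (\<integral>p. dyadic_step a (snd p) \<partial>P)"
  proof (rule integral_mono_AE[OF I isy])
    show "AE p in P. ?f p \<le> dyadic_step a (snd p)"
      using AEx AEy
    proof eventually_elim
      case (elim p)
      then show ?case using dyadic_step_perturbation[OF aD d elim] by (simp add: B_def)
    qed
  qed
  also have "\<dots> = (\<integral>y. dyadic_step a y \<partial>N)"
    unfolding snd_P[symmetric] by (subst integral_distr) auto
  finally show "D / 2 - 4 * d - D / d * e \<le> (\<integral>y. dyadic_step a y \<partial>N)" using le by linarith
qed

section \<open>Passage to \<open>largest_completed\<close> and choice of constants\<close>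

text \<open>For \<open>z \<le> 0\<close> no contract is completed, so the unspecified value is the
  same for all such \<open>z\<close>.\<close>

lemma borel_measurable_largest_completed:
  assumes "schedule X" "robust 4 X"
  shows "largest_completed X \<in> borel_measurable borel"
proof -
  have "largest_completed X z = (if 0 < z then dyadic_step (X 0) z else (GREATEST l. False))" for z
  proof (cases "0 < z")
    case False
    then have "\<not> completion_time X i \<le> z" for i
      using completion_time_pos[OF assms(1), of i] by linarith
    with False show ?thesis by (simp add: largest_completed_def)
  qed (simp add: robust_4_largest_completed[OF assms])
  then have "largest_completed X = (\<lambda>z. if 0 < z then dyadic_step (X 0) z else (GREATEST l. False))"
    by blast
  then show ?thesis by simp
qed

text \<open>A strict bound avoids the question whether the infimum is attained.\<close>

lemma EMD_near_optimal_coupling: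
  assumes "EMD M N < e"
  obtains P where "P \<in> couplings M N" "(\<integral>\<^sup>+ (x, y). ennreal \<bar>x - y\<bar> \<partial>P) < e"
  using assms unfolding EMD_def INF_less_iff by blast

lemma perturbed_ratio_le:
  fixes D s Z L :: real
  assumes "0 < D" "0 < s" "s \<le> 1 / 24"
    and Z: "Z \<le> 2 * D * ln 2 + 2 * D * s" and L: "D / 2 - 6 * D * s \<le> L"
  shows "Z / (4 * ln 2 + 104 * s) \<le> L"
proof -
  have ln2: "0 < ln (2::real)" "ln (2::real) \<le> 1" using ln_le_minus_one[of "2::real"] by auto
  have pos: "0 < 4 * ln 2 + 104 * s" using ln2 assms by linarith
  \<comment> \<open>The product below expands to
    \<open>2 * ln 2 + 52 * s - 24 * s * ln 2 - 624 * s * s\<close>. The negative terms cost at most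
    \<open>24 * s\<close> and \<open>26 * s\<close>, leaving the required \<open>2 * s\<close>; this
    is where 104 comes from.\<close>
  have "s * s \<le> s * (1 / 24)" using assms by (intro mult_left_mono) auto
  moreover have "s * ln 2 \<le> s" using ln2 assms by simp
  ultimately have "2 * ln 2 + 2 * s \<le> (1 / 2 - 6 * s) * (4 * ln 2 + 104 * s)"
    by (simp add: algebra_simps)
  then have "D * (2 * ln 2 + 2 * s) \<le> D * ((1 / 2 - 6 * s) * (4 * ln 2 + 104 * s))"
    using assms by (intro mult_left_mono) auto
  then have "Z \<le> (D / 2 - 6 * D * s) * (4 * ln 2 + 104 * s)"
    using Z by (simp add: algebra_simps)
  also have "\<dots> \<le> L * (4 * ln 2 + 104 * s)" using L pos by (intro mult_right_mono) auto
  finally show ?thesis using pos by (simp add: pos_divide_le_eq)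
qed

theorem theorem4:
  shows "\<exists>C>0. \<exists>c0>0. \<forall>D>0. \<forall>\<eta>::real. 0 < \<eta> \<and> \<eta> \<le> c0 * D \<longrightarrow>
    (\<forall>\<mu>'. pos_distribution \<mu>' \<and> EMD (mu D) \<mu>' \<le> ennreal \<eta> \<longrightarrow>
      (\<forall>X. schedule X \<and> robust 4 X \<longrightarrow>
        (\<integral>z. largest_completed X z \<partial>\<mu>')
          \<ge> (\<integral>z. z \<partial>\<mu>') / (4 * ln 2 + C * sqrt (\<eta> / D))))"
proof -
  have main: "(\<integral>z. z \<partial>\<mu>') / (4 * ln 2 + 104 * sqrt (\<eta> / D)) \<le> (\<integral>z. largest_completed X z \<partial>\<mu>')"
    if D: "0 < D" and \<eta>: "0 < \<eta>" "\<eta> \<le> 1 / 576 * D" and \<mu>': "pos_distribution \<mu>'"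
      and emd: "EMD (mu D) \<mu>' \<le> ennreal \<eta>" and X: "schedule X" "robust 4 X"
    for D \<eta> :: real and \<mu>' X
  proof -
    define s where "s = sqrt (\<eta> / D)"
    have s: "0 < s" using D \<eta> by (simp add: s_def)
    have "\<eta> / D = s\<^sup>2" using D \<eta> by (simp add: s_def)
    then have \<eta>_eq: "\<eta> = D * s * s" using D by (simp add: field_simps power2_eq_square)
    have "s \<le> sqrt ((1 / 24)\<^sup>2)"
      unfolding s_def using D \<eta> by (intro real_sqrt_le_mono) (simp add: field_simps power2_eq_square)
    then have s_le: "s \<le> 1 / 24" by simp
    have "ennreal \<eta> < ennreal (2 * \<eta>)" using \<eta> by (simp add: ennreal_less_iff)
    with emd have "EMD (mu D) \<mu>' < ennreal (2 * \<eta>)" by (rule le_less_trans)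
    then obtain P where P: "P \<in> couplings (mu D) \<mu>'"
      "(\<integral>\<^sup>+ (x, y). ennreal \<bar>x - y\<bar> \<partial>P) < ennreal (2 * \<eta>)"
      by (rule EMD_near_optimal_coupling)
    have X0: "0 < X 0" using X by (simp add: schedule_def)
    note est = coupling_expectation_bounds[OF X0 D _ \<mu>' P(1) less_imp_le[OF P(2)]]
    have Z: "(\<integral>z. z \<partial>\<mu>') \<le> 2 * D * ln 2 + 2 * D * s"
    proof -
      \<comment> \<open>The bound on the mean does not involve \<open>d\<close>, so it is
        instantiated with 1.\<close>
      have "D * s * s \<le> D * s * 1" using s s_le D by (intro mult_left_mono) auto
      then show ?thesis using est(2)[of 1] \<eta> unfolding \<eta>_eq by linarith
    qed
    \<comment> \<open>The width \<open>d = D * s\<close> makes both losses, \<open>4 * d\<close> and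
      \<open>D / d * (2 * \<eta>)\<close>, linear in \<open>s\<close>; they add up to
      \<open>6 * D * s\<close>.\<close>
    have "D / (D * s) * (2 * \<eta>) = 2 * D * s" using D s by (simp add: \<eta>_eq field_simps)
    then have "D / 2 - 6 * D * s \<le> (\<integral>z. dyadic_step (X 0) z \<partial>\<mu>')"
      using est(1)[of "D * s"] D s \<eta> by simp
    also have "\<dots> = (\<integral>z. largest_completed X z \<partial>\<mu>')"
    proof (rule integral_cong_AE)
      have sets: "sets \<mu>' = sets borel" and prob: "prob_space \<mu>'" and one: "emeasure \<mu>' {0<..} = 1"
        using \<mu>' by (auto simp: pos_distribution_def)
      interpret prob_space \<mu>' by fact
      show "dyadic_step (X 0) \<in> borel_measurable \<mu>'"
        unfolding measurable_cong_sets[OF sets refl] by measurable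
      show "largest_completed X \<in> borel_measurable \<mu>'"
        unfolding measurable_cong_sets[OF sets refl]
        by (rule borel_measurable_largest_completed[OF X])
      have "AE z in \<mu>'. z \<in> {0<..}"
        using one sets by (intro AE_prob_1) (simp add: emeasure_eq_measure)
      then show "AE z in \<mu>'. dyadic_step (X 0) z = largest_completed X z"
        by eventually_elim (simp add: robust_4_largest_completed[OF X])
    qed
    finally have L: "D / 2 - 6 * D * s \<le> (\<integral>z. largest_completed X z \<partial>\<mu>')" .
    show ?thesis using perturbed_ratio_le[OF D s s_le Z L] by (simp add: s_def)
  qed
  show ?thesis
    by (rule exI[of _ 104], rule conjI, simp, rule exI[of _ "1 / 576"]) (use main in auto)
qed

end
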